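(* Let $\alpha$ be a nanoword with letters $W_1,\dots,W_m$ and $\beta$ a nanoword with letters $X_1,\dots,X_n$, with no letters in common. Write the based matrices of $\alpha$ and $\beta$ (with respect to the orderings $s,W_1,\dots,W_m$ and $s,X_1,\dots,X_n$) as $$b_\alpha=\begin{pmatrix}0&-{}^t\overrightarrow{n_\alpha}\\ \overrightarrow{n_\alpha}&B_\alpha\end{pmatrix},\qquad b_\beta=\begin{pmatrix}0&-{}^t\overrightarrow{n_\beta}\\ \overrightarrow{n_\beta}&B_\beta\end{pmatrix},$$ where $\overrightarrow{n_\alpha}$ is the column vector with entries $n_\alpha(W_i)$ and $\overrightarrow{n_\beta}$ the column vector with entries $n_\beta(X_j)$. Then the based matrix of the composite nanoword $\alpha\beta$, with respect to the ordering $s,W_1,\dots,W_m,X_1,\dots,X_n$, is $$b_{\alpha\beta}=\begin{pmatrix}0&-{}^t\overrightarrow{n_\alpha}&-{}^t\overrightarrow{n_\beta}\\ \overrightarrow{n_\alpha}&B_\alpha&D\\ \overrightarrow{n_\beta}&-{}^tD&B_\beta\end{pmatrix}$$ where the entries of $D$ are $$b_{\alpha\beta}(W_i,X_j)=\begin{cases}0&\text{if }|W_i|=|X_j|=a,\\ -n_\beta(X_j)&\text{if }|W_i|=b,\ |X_j|=a,\\ n_\alpha(W_i)&\text{if }|W_i|=a,\ |X_j|=b,\\ n_\alpha(W_i)-n_\beta(X_j)&\text{if }|W_i|=|X_j|=b.\end{cases}$$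
   Context: A Gauss word is a finite word in which each letter appears exactly twice or not at all. A nanoword is a Gauss word together with a map $X\mapsto|X|\in\{a,b\}$ from its letters to $\{a,b\}$ ($|X|$ is the type of $X$). For nanowords $\alpha,\beta$ with no common letters, the composite $\alpha\beta$ is the concatenation of the two Gauss words, each letter keeping its type. Head and tail functions. For a letter $X$ of a nanoword $\alpha$, if $|X|=a$ the tail of $X$ is its first occurrence and the head its second occurrence; if $|X|=b$ the tail is the second occurrence and the head the first. For distinct letters $X,Y$, move rightwards along the word cyclically (from the end back to the start) from the tail of $X$ to the head of $X$; $t(X,Y)=1$ if the tail of $Y$ is passed and $0$ otherwise; $h(X,Y)=1$ if the head of $Y$ is passed and $0$ otherwise. Put $t(X,X)=h(X,X)=0$. For a letter $X$ of $\alpha$, $n_\alpha(X)=\sum_{Y\in\alpha}\bigl(t(X,Y)-h(X,Y)\bigr)$ (sum over all letters $Y$ of $\alpha$). Based matrix. The based matrix of $\alpha$ is the triple $M(\alpha)=(G,s,b_\alpha)$, where $G$ is the set of letters of $\alpha$ together with an extra special element $s$, and $b_\alpha:G\times G\to\mathbb Z$ is the skew-symmetric map with $b_\alpha(s,s)=0$, $b_\alpha(X,s)=n_\alpha(X)=-b_\alpha(s,X)$ for letters $X$, and for letters $g,k$ $$b_\alpha(g,k)=t(g,k)-h(g,k)+\sum_{c\in G\setminus\{s\}}\bigl(t(g,c)h(k,c)-h(g,c)t(k,c)\bigr).$$ (Equivalently, $b_\alpha$ records homological intersection numbers of loops associated with the crossings and with the whole curve, in a surface diagram of $\alpha$.)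 Given an ordering of $G$ with $s$ first, $b_\alpha$ is written as a matrix. *)

theory Defs
  imports "Jordan_Normal_Form.Matrix"
begin

section \<open>Nanowords\<close>

definition gauss_word :: "'a list \<Rightarrow> bool" where
  "gauss_word w \<longleftrightarrow> (\<forall>X. count_list w X = 2 \<or> count_list w X = 0)"

datatype letter_type = TypeA | TypeB

text \<open>The type map is a total function on the ambient alphabet; only its values on letters that
  occur in the word are ever used.\<close>

datatype 'a nanoword = Nanoword (word: "'a list") (ltype: "'a \<Rightarrow> letter_type")

definition nanoword :: "'a nanoword \<Rightarrow> bool" where
  "nanoword \<alpha> \<longleftrightarrow> gauss_word (word \<alpha>)"

definition letters :: "'a nanoword \<Rightarrow> 'a set" where
  "letters \<alpha> = set (word \<alpha>)"

text \<open>The composite is only meaningful when the two nanowords have no common letter.\<close>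

definition composite :: "'a nanoword \<Rightarrow> 'a nanoword \<Rightarrow> 'a nanoword" where
  "composite \<alpha> \<beta> = Nanoword (word \<alpha> @ word \<beta>)
     (\<lambda>X. if X \<in> letters \<alpha> then ltype \<alpha> X else ltype \<beta> X)"

section \<open>Head and tail functions\<close>

definition occurrences :: "'a nanoword \<Rightarrow> 'a \<Rightarrow> nat set" where
  "occurrences \<alpha> X = {i. i < length (word \<alpha>) \<and> word \<alpha> ! i = X}"

definition tail_pos :: "'a nanoword \<Rightarrow> 'a \<Rightarrow> nat" where
  "tail_pos \<alpha> X = (case ltype \<alpha> X of
     TypeA \<Rightarrow> Min (occurrences \<alpha> X) | TypeB \<Rightarrow> Max (occurrences \<alpha> X))"

definition head_pos :: "'a nanoword \<Rightarrow> 'a \<Rightarrow> nat" where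
  "head_pos \<alpha> X = (case ltype \<alpha> X of
     TypeA \<Rightarrow> Max (occurrences \<alpha> X) | TypeB \<Rightarrow> Min (occurrences \<alpha> X))"

text \<open>Position \<open>r\<close> is passed when moving rightwards from position \<open>p\<close> to position \<open>q\<close>; if \<open>q\<close> lies to
  the left of \<open>p\<close>, the movement wraps around from the end of the word to its start.\<close>

definition passed :: "nat \<Rightarrow> nat \<Rightarrow> nat \<Rightarrow> bool" where
  "passed p q r \<longleftrightarrow> (if p < q then p < r \<and> r < q else p < r \<or> r < q)"

definition tl_fun :: "'a nanoword \<Rightarrow> 'a \<Rightarrow> 'a \<Rightarrow> int" where
  "tl_fun \<alpha> X Y =
     (if X \<noteq> Y \<and> passed (tail_pos \<alpha> X) (head_pos \<alpha> X) (tail_pos \<alpha> Y) then 1 else 0)"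

definition hd_fun :: "'a nanoword \<Rightarrow> 'a \<Rightarrow> 'a \<Rightarrow> int" where
  "hd_fun \<alpha> X Y =
     (if X \<noteq> Y \<and> passed (tail_pos \<alpha> X) (head_pos \<alpha> X) (head_pos \<alpha> Y) then 1 else 0)"

definition n_fun :: "'a nanoword \<Rightarrow> 'a \<Rightarrow> int" where
  "n_fun \<alpha> X = (\<Sum>Y\<in>letters \<alpha>. tl_fun \<alpha> X Y - hd_fun \<alpha> X Y)"

section \<open>Based matrices\<close>

text \<open>\<open>Special\<close> is the element \<open>s\<close>.\<close>

datatype 'a generator = Special | Letter 'a

fun based_form :: "'a nanoword \<Rightarrow> 'a generator \<Rightarrow> 'a generator \<Rightarrow> int" where
  "based_form \<alpha> Special Special = 0"
| "based_form \<alpha> (Letter X) Special = n_fun \<alpha> X"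
| "based_form \<alpha> Special (Letter X) = - n_fun \<alpha> X"
| "based_form \<alpha> (Letter g) (Letter k) = tl_fun \<alpha> g k - hd_fun \<alpha> g k +
     (\<Sum>c\<in>letters \<alpha>. tl_fun \<alpha> g c * hd_fun \<alpha> k c - hd_fun \<alpha> g c * tl_fun \<alpha> k c)"

type_synonym 'a based_mat =
  "'a generator set \<times> 'a generator \<times> ('a generator \<Rightarrow> 'a generator \<Rightarrow> int)"

definition based_matrix :: "'a nanoword \<Rightarrow> 'a based_mat" where
  "based_matrix \<alpha> = (insert Special (Letter ` letters \<alpha>), Special, based_form \<alpha>)"

text \<open>The matrix of a based matrix \<open>(G, s, b)\<close> with respect to the ordering of \<open>G\<close> that begins with
  \<open>s\<close> and continues with the letters in the list \<open>Ws\<close>.\<close>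

definition matrix_wrt :: "'a based_mat \<Rightarrow> 'a list \<Rightarrow> int mat" where
  "matrix_wrt M Ws = (case M of (G, s, b) \<Rightarrow>
     (let gs = s # map Letter Ws
      in mat (length gs) (length gs) (\<lambda>(i, j). b (gs ! i) (gs ! j))))"

definition n_col :: "'a nanoword \<Rightarrow> 'a list \<Rightarrow> int mat" where
  "n_col \<alpha> Ws = mat (length Ws) 1 (\<lambda>(i, j). n_fun \<alpha> (Ws ! i))"

definition letter_block :: "'a nanoword \<Rightarrow> 'a list \<Rightarrow> int mat" where
  "letter_block \<alpha> Ws = mat (length Ws) (length Ws)
     (\<lambda>(i, j). based_form \<alpha> (Letter (Ws ! i)) (Letter (Ws ! j)))"

definition D_entry :: "'a nanoword \<Rightarrow> 'a nanoword \<Rightarrow> 'a \<Rightarrow> 'a \<Rightarrow> int" where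
  "D_entry \<alpha> \<beta> W X = (case (ltype \<alpha> W, ltype \<beta> X) of
       (TypeA, TypeA) \<Rightarrow> 0
     | (TypeB, TypeA) \<Rightarrow> - n_fun \<beta> X
     | (TypeA, TypeB) \<Rightarrow> n_fun \<alpha> W
     | (TypeB, TypeB) \<Rightarrow> n_fun \<alpha> W - n_fun \<beta> X)"

definition D_block :: "'a nanoword \<Rightarrow> 'a nanoword \<Rightarrow> 'a list \<Rightarrow> 'a list \<Rightarrow> int mat" where
  "D_block \<alpha> \<beta> Ws Xs = mat (length Ws) (length Xs) (\<lambda>(i, j). D_entry \<alpha> \<beta> (Ws ! i) (Xs ! j))"

text \<open>Side-by-side juxtaposition, the column analogue of \<^const>\<open>append_rows\<close>.\<close>

definition append_cols :: "'a :: zero mat \<Rightarrow> 'a mat \<Rightarrow> 'a mat" (infixr \<open>@\<^sub>c\<close> 66) where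
  "A @\<^sub>c B = four_block_mat A B (0\<^sub>m 0 (dim_col A)) (0\<^sub>m 0 (dim_col B))"

end

theory Submission
  imports Defs
begin

text \<open>Seen from a letter \<open>W\<close> of one factor, all positions of the other factor lie on the same side
  of \<open>W\<close>: both occurrences of a letter there are passed if \<open>W\<close> has type \<open>b\<close>, and neither is if \<open>W\<close>
  has type \<open>a\<close>.  Hence the tail and head functions agree on a letter of the other factor, with common
  value \<open>wrap W\<close>, and its contributions to \<open>n(W)\<close> and to the form on two letters of the same factor
  cancel.  For letters \<open>W\<close>, \<open>X\<close> of different factors the defining sum splits over the factors into
  \<open>wrap X * n(W) - wrap W * n(X)\<close>.\<close>

subsection \<open>Positions in the composite\<close>

lemma word_composite [simp]: "word (composite \<alpha> \<beta>) = word \<alpha> @ word \<beta>"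
  by (simp add: composite_def)

lemma letters_composite: "letters (composite \<alpha> \<beta>) = letters \<alpha> \<union> letters \<beta>"
  by (simp add: letters_def)

lemma finite_letters [simp]: "finite (letters \<alpha>)"
  by (simp add: letters_def)

lemma finite_occurrences [simp]: "finite (occurrences \<alpha> X)"
  by (simp add: occurrences_def)

lemma card_occurrences: "card (occurrences \<alpha> X) = count_list (word \<alpha>) X"
  by (simp add: occurrences_def count_list_eq_length_filter length_filter_conv_card eq_commute)

lemma occurrences_nonempty: "X \<in> letters \<alpha> \<Longrightarrow> occurrences \<alpha> X \<noteq> {}"
  by (auto simp: occurrences_def letters_def in_set_conv_nth)

text \<open>The Gauss word condition enters here: a letter of the word has exactly two occurrences,
  so its extreme positions are distinct.\<close>

lemma Min_less_Max_occurrences: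
  assumes "nanoword \<alpha>" "X \<in> letters \<alpha>"
  shows "Min (occurrences \<alpha> X) < Max (occurrences \<alpha> X)"
proof -
  have "card (occurrences \<alpha> X) = 2"
    using assms unfolding card_occurrences nanoword_def gauss_word_def letters_def
    by (metis count_list_0_iff)
  then obtain i j where "occurrences \<alpha> X = {i, j}" "i \<noteq> j"
    by (auto simp: card_2_iff)
  then show ?thesis
    by (auto simp: min_def max_def)
qed

lemma tail_pos_less: "X \<in> letters \<alpha> \<Longrightarrow> tail_pos \<alpha> X < length (word \<alpha>)"
  using Min_in[OF finite_occurrences occurrences_nonempty, of X \<alpha>]
    Max_in[OF finite_occurrences occurrences_nonempty, of X \<alpha>]
  by (auto simp: tail_pos_def occurrences_def split: letter_type.split)

lemma head_pos_less: "X \<in> letters \<alpha> \<Longrightarrow> head_pos \<alpha> X < length (word \<alpha>)"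
  using Min_in[OF finite_occurrences occurrences_nonempty, of X \<alpha>]
    Max_in[OF finite_occurrences occurrences_nonempty, of X \<alpha>]
  by (auto simp: head_pos_def occurrences_def split: letter_type.split)

text \<open>This selects the branch of \<open>passed\<close>: the arc from tail to head runs through
  the end of the word exactly for type b.\<close>

lemma tail_pos_less_head_pos_iff:
  assumes "nanoword \<alpha>" "X \<in> letters \<alpha>"
  shows "tail_pos \<alpha> X < head_pos \<alpha> X \<longleftrightarrow> ltype \<alpha> X = TypeA"
  using Min_less_Max_occurrences[OF assms]
  by (auto simp: tail_pos_def head_pos_def split: letter_type.split)

lemma ltype_composite_left:
  "X \<in> letters \<alpha> \<Longrightarrow> ltype (composite \<alpha> \<beta>) X = ltype \<alpha> X"
  by (simp add: composite_def)

lemma ltype_composite_right: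
  "X \<notin> letters \<alpha> \<Longrightarrow> ltype (composite \<alpha> \<beta>) X = ltype \<beta> X"
  by (simp add: composite_def)

lemma occurrences_composite_left:
  assumes "X \<notin> letters \<beta>"
  shows "occurrences (composite \<alpha> \<beta>) X = occurrences \<alpha> X"
proof -
  have "word \<beta> ! i \<noteq> X" if "i < length (word \<beta>)" for i
    using assms that by (auto simp: letters_def)
  then have "word \<beta> ! (i - length (word \<alpha>)) \<noteq> X"
    if "\<not> i < length (word \<alpha>)" "i < length (word \<alpha>) + length (word \<beta>)" for i
    using that by simp
  then show ?thesis
    by (fastforce simp: occurrences_def nth_append split: if_splits)
qed

lemma occurrences_composite_right:
  assumes "X \<notin> letters \<alpha>"
  shows "occurrences (composite \<alpha> \<beta>) X = (+) (length (word \<alpha>)) ` occurrences \<beta> X"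
proof (intro equalityI subsetI)
  fix i
  assume i: "i \<in> occurrences (composite \<alpha> \<beta>) X"
  then have "\<not> i < length (word \<alpha>)"
    using assms by (auto simp: occurrences_def letters_def nth_append)
  with i have "i - length (word \<alpha>) \<in> occurrences \<beta> X"
      "i = length (word \<alpha>) + (i - length (word \<alpha>))"
    by (auto simp: occurrences_def nth_append)
  then show "i \<in> (+) (length (word \<alpha>)) ` occurrences \<beta> X"
    by blast
qed (auto simp: occurrences_def)

lemma pos_composite_left:
  assumes "X \<in> letters \<alpha>" "X \<notin> letters \<beta>"
  shows "tail_pos (composite \<alpha> \<beta>) X = tail_pos \<alpha> X"
    and "head_pos (composite \<alpha> \<beta>) X = head_pos \<alpha> X"
  using assms
  by (simp_all add: tail_pos_def head_pos_def ltype_composite_left occurrences_composite_left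
      split: letter_type.split)

text \<open>Adding the length of the left word is monotone, so it commutes with \<open>Min\<close>
  and \<open>Max\<close>, whichever of them the type selects.\<close>

lemma pos_composite_right:
  assumes "X \<notin> letters \<alpha>" "X \<in> letters \<beta>"
  shows "tail_pos (composite \<alpha> \<beta>) X = length (word \<alpha>) + tail_pos \<beta> X"
    and "head_pos (composite \<alpha> \<beta>) X = length (word \<alpha>) + head_pos \<beta> X"
proof -
  have "mono ((+) (length (word \<alpha>)))"
    by (simp add: mono_def)
  from mono_Min_commute[OF this finite_occurrences occurrences_nonempty[OF assms(2)]]
    mono_Max_commute[OF this finite_occurrences occurrences_nonempty[OF assms(2)]]
  show "tail_pos (composite \<alpha> \<beta>) X = length (word \<alpha>) + tail_pos \<beta> X"
    "head_pos (composite \<alpha> \<beta>) X = length (word \<alpha>) + head_pos \<beta> X"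
    using assms(1)
    by (simp_all add: tail_pos_def head_pos_def ltype_composite_right occurrences_composite_right
        split: letter_type.split)
qed

subsection \<open>The form of the composite\<close>

definition wrap :: "'a nanoword \<Rightarrow> 'a \<Rightarrow> int" where
  "wrap \<alpha> X = (if ltype \<alpha> X = TypeB then 1 else 0)"

text \<open>Only order comparisons occur in \<open>passed\<close>, so shifting the right factor does
  not affect its tail and head functions on its own letters.\<close>

lemma passed_add [simp]: "passed (k + p) (k + q) (k + r) \<longleftrightarrow> passed p q r"
  by (simp add: passed_def)

lemma n_fun_diff: "n_fun \<alpha> X = (\<Sum>Y\<in>letters \<alpha>. tl_fun \<alpha> X Y) - (\<Sum>Y\<in>letters \<alpha>. hd_fun \<alpha> X Y)"
  by (simp add: n_fun_def sum_subtractf)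

text \<open>Reading the type as 0 or 1 merges the four cases into one expression, the shape in which
  the sums for the mixed blocks come out.\<close>

lemma D_entry_wrap: "D_entry \<alpha> \<beta> W X = wrap \<beta> X * n_fun \<alpha> W - wrap \<alpha> W * n_fun \<beta> X"
  by (simp add: D_entry_def wrap_def split: letter_type.split)

context
  fixes \<alpha> \<beta> :: "'a nanoword"
  assumes nanowords: "nanoword \<alpha>" "nanoword \<beta>"
    and disjoint: "letters \<alpha> \<inter> letters \<beta> = {}"
begin

lemma disjoint_letters:
  "X \<in> letters \<alpha> \<Longrightarrow> X \<notin> letters \<beta>" "X \<in> letters \<beta> \<Longrightarrow> X \<notin> letters \<alpha>"
  using disjoint by auto

lemmas pos_composite =
  pos_composite_left[OF _ disjoint_letters(1)] pos_composite_right[OF disjoint_letters(2)]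

lemma sum_letters_composite:
  "(\<Sum>c\<in>letters (composite \<alpha> \<beta>). f c) = (\<Sum>c\<in>letters \<alpha>. f c) + (\<Sum>c\<in>letters \<beta>. f c)"
  unfolding letters_composite by (rule sum.union_disjoint) (use disjoint in auto)

lemma tl_hd_composite_left:
  assumes "W \<in> letters \<alpha>" "Y \<in> letters \<alpha>"
  shows "tl_fun (composite \<alpha> \<beta>) W Y = tl_fun \<alpha> W Y"
    and "hd_fun (composite \<alpha> \<beta>) W Y = hd_fun \<alpha> W Y"
  using assms by (simp_all add: tl_fun_def hd_fun_def pos_composite)

lemma tl_hd_composite_right:
  assumes "X \<in> letters \<beta>" "Y \<in> letters \<beta>"
  shows "tl_fun (composite \<alpha> \<beta>) X Y = tl_fun \<beta> X Y"
    and "hd_fun (composite \<alpha> \<beta>) X Y = hd_fun \<beta> X Y"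
  using assms by (simp_all add: tl_fun_def hd_fun_def pos_composite)

text \<open>Both positions of \<open>X\<close> lie to the right of those of \<open>W\<close>. For
  type a the arc of \<open>W\<close> stays between the occurrences of \<open>W\<close> and misses
  them; for type b it leaves through the end of the word and passes them.\<close>

lemma tl_hd_composite_left_right:
  assumes W: "W \<in> letters \<alpha>" and X: "X \<in> letters \<beta>"
  shows "tl_fun (composite \<alpha> \<beta>) W X = wrap \<alpha> W"
    and "hd_fun (composite \<alpha> \<beta>) W X = wrap \<alpha> W"
proof -
  have "W \<noteq> X"
    using W X disjoint by auto
  then show "tl_fun (composite \<alpha> \<beta>) W X = wrap \<alpha> W" "hd_fun (composite \<alpha> \<beta>) W X = wrap \<alpha> W"
    using W X tail_pos_less[OF W] head_pos_less[OF W] tail_pos_less_head_pos_iff[OF nanowords(1) W]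
    by (cases "ltype \<alpha> W"; simp add: tl_fun_def hd_fun_def pos_composite wrap_def passed_def)+
qed

text \<open>Here the other factor lies to the left, and an arc of type b passes it after re-entering
  at the start of the word.\<close>

lemma tl_hd_composite_right_left:
  assumes X: "X \<in> letters \<beta>" and W: "W \<in> letters \<alpha>"
  shows "tl_fun (composite \<alpha> \<beta>) X W = wrap \<beta> X"
    and "hd_fun (composite \<alpha> \<beta>) X W = wrap \<beta> X"
proof -
  have "X \<noteq> W"
    using W X disjoint by auto
  then show "tl_fun (composite \<alpha> \<beta>) X W = wrap \<beta> X" "hd_fun (composite \<alpha> \<beta>) X W = wrap \<beta> X"
    using W X tail_pos_less[OF W] head_pos_less[OF W] tail_pos_less_head_pos_iff[OF nanowords(2) X]
    by (cases "ltype \<beta> X"; simp add: tl_fun_def hd_fun_def pos_composite wrap_def passed_def)+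
qed

lemmas tl_hd_composite =
  tl_hd_composite_left tl_hd_composite_right
  tl_hd_composite_left_right tl_hd_composite_right_left

text \<open>Each letter of \<beta> contributes \<open>wrap \<alpha> W - wrap \<alpha> W\<close> to
  the sum.\<close>

lemma n_fun_composite_left: "W \<in> letters \<alpha> \<Longrightarrow> n_fun (composite \<alpha> \<beta>) W = n_fun \<alpha> W"
  by (simp add: n_fun_def sum_letters_composite tl_hd_composite)

lemma n_fun_composite_right: "X \<in> letters \<beta> \<Longrightarrow> n_fun (composite \<alpha> \<beta>) X = n_fun \<beta> X"
  by (simp add: n_fun_def sum_letters_composite tl_hd_composite)

text \<open>Each letter of \<beta> contributes the product
  \<open>wrap \<alpha> W * wrap \<alpha> W'\<close> once with each sign, so only the sum over
  \<alpha> survives.\<close>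

lemma based_form_composite_left:
  assumes "W \<in> letters \<alpha>" "W' \<in> letters \<alpha>"
  shows "based_form (composite \<alpha> \<beta>) (Letter W) (Letter W') = based_form \<alpha> (Letter W) (Letter W')"
  using assms by (simp add: sum_letters_composite tl_hd_composite)

lemma based_form_composite_right:
  assumes "X \<in> letters \<beta>" "X' \<in> letters \<beta>"
  shows "based_form (composite \<alpha> \<beta>) (Letter X) (Letter X') = based_form \<beta> (Letter X) (Letter X')"
  using assms by (simp add: sum_letters_composite tl_hd_composite)

text \<open>The leading difference vanishes. In the sum over \<alpha> the factor
  \<open>wrap \<beta> X\<close> comes out and leaves \<open>n_fun \<alpha> W\<close>; in the sum
  over \<beta> the factor \<open>wrap \<alpha> W\<close> comes out and leaves
  \<open>- n_fun \<beta> X\<close>.\<close>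

lemma based_form_composite_left_right:
  assumes "W \<in> letters \<alpha>" "X \<in> letters \<beta>"
  shows "based_form (composite \<alpha> \<beta>) (Letter W) (Letter X) = D_entry \<alpha> \<beta> W X"
  using assms
  by (simp add: sum_letters_composite tl_hd_composite D_entry_wrap n_fun_diff sum_subtractf
      algebra_simps flip: sum_distrib_left sum_distrib_right)

text \<open>The same computation with the arguments exchanged, which flips the sign of both sums; it
  yields the block \<open>- transpose_mat D\<close>.\<close>

lemma based_form_composite_right_left:
  assumes "X \<in> letters \<beta>" "W \<in> letters \<alpha>"
  shows "based_form (composite \<alpha> \<beta>) (Letter X) (Letter W) = - D_entry \<alpha> \<beta> W X"
  using assms
  by (simp add: sum_letters_composite tl_hd_composite D_entry_wrap n_fun_diff sum_subtractf
      algebra_simps flip: sum_distrib_left sum_distrib_right)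

lemmas based_form_composite =
  n_fun_composite_left n_fun_composite_right
  based_form_composite_left based_form_composite_right
  based_form_composite_left_right based_form_composite_right_left

end

subsection \<open>Block matrices\<close>

lemma dim_append_cols [simp]:
  "dim_row (A @\<^sub>c B) = dim_row A" "dim_col (A @\<^sub>c B) = dim_col A + dim_col B"
  by (simp_all add: append_cols_def)

text \<open>The lower blocks in \<open>append_cols\<close> have no rows, so only the upper two are
  ever read.\<close>

lemma index_append_cols [simp]:
  "i < dim_row A \<Longrightarrow> j < dim_col A + dim_col B \<Longrightarrow>
    (A @\<^sub>c B) $$ (i, j) = (if j < dim_col A then A $$ (i, j) else B $$ (i, j - dim_col A))"
  by (simp add: append_cols_def)

lemma dim_append_rows [simp]:
  "dim_row (A @\<^sub>r B) = dim_row A + dim_row B" "dim_col (A @\<^sub>r B) = dim_col A"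
  by (simp_all add: append_rows_def)

lemma index_append_rows [simp]:
  "i < dim_row A + dim_row B \<Longrightarrow> j < dim_col A \<Longrightarrow>
    (A @\<^sub>r B) $$ (i, j) = (if i < dim_row A then A $$ (i, j) else B $$ (i - dim_row A, j))"
  by (simp add: append_rows_def)

text \<open>The three cases are the block rows or columns of the composite matrix: the special
  element, the letters of \<alpha> and those of \<beta>.\<close>

lemma less_Suc_add_cases:
  fixes i m n :: nat
  assumes "i < Suc (m + n)"
  obtains "i = 0" | k where "k < m" "i = Suc k" | k where "k < n" "i = Suc (m + k)"
proof (cases i)
  case (Suc i')
  show thesis
  proof (cases "i' < m")
    case False
    then have "i' - m < n" "i = Suc (m + (i' - m))"
      using assms Suc by auto
    then show thesis
      by (rule that(3))
  qed (use Suc that(2) in blast)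
qed (use that(1) in blast)

lemma dim_matrix_wrt [simp]:
  "dim_row (matrix_wrt (G, s, b) Ws) = Suc (length Ws)"
  "dim_col (matrix_wrt (G, s, b) Ws) = Suc (length Ws)"
  by (simp_all add: matrix_wrt_def Let_def)

lemma index_matrix_wrt [simp]:
  "i < Suc (length Ws) \<Longrightarrow> j < Suc (length Ws) \<Longrightarrow>
    matrix_wrt (G, s, b) Ws $$ (i, j) = b ((s # map Letter Ws) ! i) ((s # map Letter Ws) ! j)"
  by (simp add: matrix_wrt_def Let_def)

lemma dim_blocks [simp]:
  "dim_row (n_col \<alpha> Ws) = length Ws" "dim_col (n_col \<alpha> Ws) = 1"
  "dim_row (letter_block \<alpha> Ws) = length Ws" "dim_col (letter_block \<alpha> Ws) = length Ws"
  "dim_row (D_block \<alpha> \<beta> Ws Xs) = length Ws" "dim_col (D_block \<alpha> \<beta> Ws Xs) = length Xs"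
  by (simp_all add: n_col_def letter_block_def D_block_def)

lemma index_n_col [simp]: "i < length Ws \<Longrightarrow> n_col \<alpha> Ws $$ (i, 0) = n_fun \<alpha> (Ws ! i)"
  by (simp add: n_col_def)

lemma index_letter_block [simp]:
  "i < length Ws \<Longrightarrow> j < length Ws \<Longrightarrow>
    letter_block \<alpha> Ws $$ (i, j) = based_form \<alpha> (Letter (Ws ! i)) (Letter (Ws ! j))"
  by (simp add: letter_block_def)

lemma index_D_block [simp]:
  "i < length Ws \<Longrightarrow> j < length Xs \<Longrightarrow>
    D_block \<alpha> \<beta> Ws Xs $$ (i, j) = D_entry \<alpha> \<beta> (Ws ! i) (Xs ! j)"
  by (simp add: D_block_def)

text \<open>The border comes from the first three equations of \<open>based_form\<close>; this gives
  the block shape of both factors.\<close>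

lemma matrix_wrt_based_matrix:
  "matrix_wrt (based_matrix \<alpha>) Ws =
    (0\<^sub>m 1 1 @\<^sub>c (- transpose_mat (n_col \<alpha> Ws))) @\<^sub>r (n_col \<alpha> Ws @\<^sub>c letter_block \<alpha> Ws)"
  (is "_ = ?R")
proof (rule eq_matI)
  fix i j
  assume "i < dim_row ?R" "j < dim_col ?R"
  then show "matrix_wrt (based_matrix \<alpha>) Ws $$ (i, j) = ?R $$ (i, j)"
    \<comment> \<open>Without its fourth equation \<open>based_form\<close> stays folded on letters
      and matches the entries of \<open>letter_block\<close>.\<close>
    by (cases i; cases j) (simp_all add: based_matrix_def del: based_form.simps(4))
qed (simp_all add: based_matrix_def)

theorem proposition9p1:
  fixes \<alpha> \<beta> :: "'a nanoword" and Ws Xs :: "'a list"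
  assumes "nanoword \<alpha>" and "nanoword \<beta>"
    and "letters \<alpha> \<inter> letters \<beta> = {}"
    and "distinct Ws" and "set Ws = letters \<alpha>"
    and "distinct Xs" and "set Xs = letters \<beta>"
  shows "let n\<^sub>\<alpha> = n_col \<alpha> Ws; n\<^sub>\<beta> = n_col \<beta> Xs;
             B\<^sub>\<alpha> = letter_block \<alpha> Ws; B\<^sub>\<beta> = letter_block \<beta> Xs;
             D = D_block \<alpha> \<beta> Ws Xs
         in matrix_wrt (based_matrix \<alpha>) Ws =
              (0\<^sub>m 1 1 @\<^sub>c (- transpose_mat n\<^sub>\<alpha>)) @\<^sub>r
              (n\<^sub>\<alpha>     @\<^sub>c B\<^sub>\<alpha>)
          \<and> matrix_wrt (based_matrix \<beta>) Xs =
              (0\<^sub>m 1 1 @\<^sub>c (- transpose_mat n\<^sub>\<beta>)) @\<^sub>r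
              (n\<^sub>\<beta>     @\<^sub>c B\<^sub>\<beta>)
          \<and> matrix_wrt (based_matrix (composite \<alpha> \<beta>)) (Ws @ Xs) =
              (0\<^sub>m 1 1 @\<^sub>c (- transpose_mat n\<^sub>\<alpha>) @\<^sub>c (- transpose_mat n\<^sub>\<beta>)) @\<^sub>r
              (n\<^sub>\<alpha>     @\<^sub>c B\<^sub>\<alpha>                   @\<^sub>c D) @\<^sub>r
              (n\<^sub>\<beta>     @\<^sub>c (- transpose_mat D)  @\<^sub>c B\<^sub>\<beta>)"
proof -
  note form = based_form_composite[OF assms(1-3)]
  have Ws: "Ws ! i \<in> letters \<alpha>" if "i < length Ws" for i
    using assms(5) that by auto
  have Xs: "Xs ! i \<in> letters \<beta>" if "i < length Xs" for i
    using assms(7) that by auto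
  let ?n = "n_col \<alpha> Ws" and ?n' = "n_col \<beta> Xs"
  let ?B = "letter_block \<alpha> Ws" and ?B' = "letter_block \<beta> Xs"
  let ?D = "D_block \<alpha> \<beta> Ws Xs" and ?M = "matrix_wrt (based_matrix (composite \<alpha> \<beta>)) (Ws @ Xs)"
  let ?R\<^sub>0 = "0\<^sub>m 1 1 @\<^sub>c (- transpose_mat ?n) @\<^sub>c (- transpose_mat ?n')"
  let ?R\<^sub>1 = "?n @\<^sub>c ?B @\<^sub>c ?D"
  let ?R\<^sub>2 = "?n' @\<^sub>c (- transpose_mat ?D) @\<^sub>c ?B'"
  let ?R = "?R\<^sub>0 @\<^sub>r ?R\<^sub>1 @\<^sub>r ?R\<^sub>2"
  have "?M = ?R"
  proof (rule eq_matI)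
    fix i j
    assume "i < dim_row ?R" "j < dim_col ?R"
    then have "i < Suc (length Ws + length Xs)" "j < Suc (length Ws + length Xs)"
      by simp_all
    then show "?M $$ (i, j) = ?R $$ (i, j)"
      \<comment> \<open>Splitting both indices gives nine blocks. Keeping \<open>based_form\<close>
        folded lets the rules in \<open>form\<close> rewrite the four letter blocks, while their
        rules for \<open>n_fun\<close> settle the border.\<close>
      by (elim less_Suc_add_cases)
        (simp_all add: based_matrix_def nth_append form Ws Xs del: based_form.simps(4))
  qed (simp_all add: based_matrix_def)
  then show ?thesis
    unfolding Let_def by (intro conjI matrix_wrt_based_matrix)
qed

end
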